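(* Let $\mathcal{E}:L^2(X,m)\to[0,\infty]$ be a quasilinear, symmetric Dirichlet form with Dirichlet space $(\mathfrak{D},\|\cdot\|_{\mathfrak{D}})$. Then the lattice operations $(u,v)\mapsto u\wedge v$ and $(u,v)\mapsto u\vee v$ are continuous as maps from $\mathfrak{D}\times\mathfrak{D}$ to $\mathfrak{D}$ (with respect to $\|\cdot\|_{\mathfrak{D}}$).
   Context: $X$ is a countably generated Borel space and $m$ a $\sigma$-finite Borel measure on $X$ with $\operatorname{supp}(m)=X$; $L^2(X,m)$ is the real $L^2$ space; $u\wedge v$ and $u\vee v$ denote the pointwise a.e. minimum and maximum; $w_+=w\vee 0$, $w_-=(-w)\vee 0$. A Dirichlet form is a convex, lower semicontinuous functional $\mathcal{E}:L^2(X,m)\to[0,\infty]$ with dense effective domain $\operatorname{dom}\mathcal{E}=\{u\mid\mathcal{E}(u)<\infty\}$ such that for all $u,v\in L^2(X,m)$ and $\alpha>0$: (1) $\mathcal{E}(u\wedge v)+\mathcal{E}(u\vee v)\le\mathcal{E}(u)+\mathcal{E}(v)$; (2) $\mathcal{E}(v+p)+\mathcal{E}(u-p)\le\mathcal{E}(u)+\mathcal{E}(v)$, where $p=\tfrac12\big((u-v+\alpha)_+-(u-v-\alpha)_-\big)$. It is symmetric if $\mathcal{E}(0)=0$ and $\mathcal{E}(-u)=\mathcal{E}(u)$ for all $u$, and quasilinear if $\operatorname{dom}\mathcal{E}$ is a linear subspace of $L^2(X,m)$. For symmetric $\mathcal{E}$ put $\mathcal{E}_1(u)=\|u\|_{L^2}^2+\mathcal{E}(u)$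 and $\|u\|_{\mathfrak{D}}=\inf\{\lambda>0\mid\mathcal{E}_1(u/\lambda)\le1\}\in[0,\infty]$ for $u\in L^2(X,m)$. The Dirichlet space is $\mathfrak{D}=\{u\in L^2(X,m)\mid\|u\|_{\mathfrak{D}}<\infty\}$, a Banach space under $\|\cdot\|_{\mathfrak{D}}$ which is closed under $\wedge$ and $\vee$. *)

theory Defs
  imports "HOL-Analysis.Analysis"
begin

text \<open>The underlying space is a type \<^typ>\<open>'a\<close> with a topology, and \<^term>\<open>M\<close> is a measure on its
  Borel sets.\<close>

definition countably_generated_borel :: "'a::topological_space itself \<Rightarrow> bool" where
  "countably_generated_borel _ \<longleftrightarrow>
     (\<exists>C :: 'a set set. countable C \<and> sets (borel :: 'a measure) = sigma_sets UNIV C)"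

definition measure_support :: "'a::topological_space measure \<Rightarrow> 'a set" where
  "measure_support M = {x. \<forall>U. open U \<and> x \<in> U \<longrightarrow> 0 < emeasure M U}"

text \<open>Elements of \<open>L\<^sup>2(X,m)\<close> are represented by square integrable functions, without passing to the
  quotient by almost everywhere equality. Functionals on \<open>L\<^sup>2(X,m)\<close> are then those functionals on
  representatives that do not distinguish almost everywhere equal functions (\<open>well_defined_on_L2\<close>);
  their values outside \<open>L2 M\<close> are irrelevant. All norms below are seminorms on representatives.\<close>

definition L2 :: "'a measure \<Rightarrow> ('a \<Rightarrow> real) set" where
  "L2 M = {u \<in> borel_measurable M. integrable M (\<lambda>x. (u x)\<^sup>2)}"

definition L2_norm :: "'a measure \<Rightarrow> ('a \<Rightarrow> real) \<Rightarrow> real" where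
  "L2_norm M u = sqrt (\<integral>x. (u x)\<^sup>2 \<partial>M)"

definition well_defined_on_L2 :: "'a measure \<Rightarrow> (('a \<Rightarrow> real) \<Rightarrow> ennreal) \<Rightarrow> bool" where
  "well_defined_on_L2 M E \<longleftrightarrow>
     (\<forall>u\<in>L2 M. \<forall>v\<in>L2 M. (AE x in M. u x = v x) \<longrightarrow> E u = E v)"

definition convex_on_L2 :: "'a measure \<Rightarrow> (('a \<Rightarrow> real) \<Rightarrow> ennreal) \<Rightarrow> bool" where
  "convex_on_L2 M E \<longleftrightarrow>
     (\<forall>u\<in>L2 M. \<forall>v\<in>L2 M. \<forall>t::real. 0 \<le> t \<and> t \<le> 1 \<longrightarrow>
        E (\<lambda>x. t * u x + (1 - t) * v x) \<le> ennreal t * E u + ennreal (1 - t) * E v)"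

definition lsc_on_L2 :: "'a measure \<Rightarrow> (('a \<Rightarrow> real) \<Rightarrow> ennreal) \<Rightarrow> bool" where
  "lsc_on_L2 M E \<longleftrightarrow>
     (\<forall>u\<in>L2 M. \<forall>c. c < E u \<longrightarrow>
        (\<exists>\<delta>>0. \<forall>v\<in>L2 M. L2_norm M (\<lambda>x. v x - u x) < \<delta> \<longrightarrow> c < E v))"

definition eff_dom :: "'a measure \<Rightarrow> (('a \<Rightarrow> real) \<Rightarrow> ennreal) \<Rightarrow> ('a \<Rightarrow> real) set" where
  "eff_dom M E = {u \<in> L2 M. E u < \<infinity>}"

definition dense_in_L2 :: "'a measure \<Rightarrow> ('a \<Rightarrow> real) set \<Rightarrow> bool" where
  "dense_in_L2 M S \<longleftrightarrow>
     (\<forall>u\<in>L2 M. \<forall>\<epsilon>>0. \<exists>v\<in>S. L2_norm M (\<lambda>x. v x - u x) < \<epsilon>)"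

definition meet_fun :: "('a \<Rightarrow> real) \<Rightarrow> ('a \<Rightarrow> real) \<Rightarrow> 'a \<Rightarrow> real" where
  "meet_fun u v = (\<lambda>x. min (u x) (v x))"

definition join_fun :: "('a \<Rightarrow> real) \<Rightarrow> ('a \<Rightarrow> real) \<Rightarrow> 'a \<Rightarrow> real" where
  "join_fun u v = (\<lambda>x. max (u x) (v x))"

definition pos_part :: "real \<Rightarrow> real" where
  "pos_part w = max w 0"

definition neg_part :: "real \<Rightarrow> real" where
  "neg_part w = max (- w) 0"

definition trunc_diff :: "real \<Rightarrow> ('a \<Rightarrow> real) \<Rightarrow> ('a \<Rightarrow> real) \<Rightarrow> 'a \<Rightarrow> real" where
  "trunc_diff \<alpha> u v = (\<lambda>x. 1/2 * (pos_part (u x - v x + \<alpha>) - neg_part (u x - v x - \<alpha>)))"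

definition dirichlet_form :: "'a measure \<Rightarrow> (('a \<Rightarrow> real) \<Rightarrow> ennreal) \<Rightarrow> bool" where
  "dirichlet_form M E \<longleftrightarrow>
     well_defined_on_L2 M E \<and> convex_on_L2 M E \<and> lsc_on_L2 M E \<and> dense_in_L2 M (eff_dom M E) \<and>
     (\<forall>u\<in>L2 M. \<forall>v\<in>L2 M. E (meet_fun u v) + E (join_fun u v) \<le> E u + E v) \<and>
     (\<forall>u\<in>L2 M. \<forall>v\<in>L2 M. \<forall>\<alpha>>0.
        E (\<lambda>x. v x + trunc_diff \<alpha> u v x) + E (\<lambda>x. u x - trunc_diff \<alpha> u v x) \<le> E u + E v)"

definition symmetric_form :: "'a measure \<Rightarrow> (('a \<Rightarrow> real) \<Rightarrow> ennreal) \<Rightarrow> bool" where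
  "symmetric_form M E \<longleftrightarrow> E (\<lambda>x. 0) = 0 \<and> (\<forall>u\<in>L2 M. E (\<lambda>x. - u x) = E u)"

definition quasilinear_form :: "'a measure \<Rightarrow> (('a \<Rightarrow> real) \<Rightarrow> ennreal) \<Rightarrow> bool" where
  "quasilinear_form M E \<longleftrightarrow>
     (\<lambda>x. 0) \<in> eff_dom M E \<and>
     (\<forall>u\<in>eff_dom M E. \<forall>v\<in>eff_dom M E. (\<lambda>x. u x + v x) \<in> eff_dom M E) \<and>
     (\<forall>u\<in>eff_dom M E. \<forall>c::real. (\<lambda>x. c * u x) \<in> eff_dom M E)"

definition E1 :: "'a measure \<Rightarrow> (('a \<Rightarrow> real) \<Rightarrow> ennreal) \<Rightarrow> ('a \<Rightarrow> real) \<Rightarrow> ennreal" where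
  "E1 M E u = ennreal ((L2_norm M u)\<^sup>2) + E u"

definition dirichlet_norm :: "'a measure \<Rightarrow> (('a \<Rightarrow> real) \<Rightarrow> ennreal) \<Rightarrow> ('a \<Rightarrow> real) \<Rightarrow> ennreal" where
  "dirichlet_norm M E u = Inf {ennreal l | l::real. 0 < l \<and> E1 M E (\<lambda>x. u x / l) \<le> 1}"

definition dirichlet_space :: "'a measure \<Rightarrow> (('a \<Rightarrow> real) \<Rightarrow> ennreal) \<Rightarrow> ('a \<Rightarrow> real) set" where
  "dirichlet_space M E = {u \<in> L2 M. dirichlet_norm M E u < \<infinity>}"

text \<open>The (pseudo)metric topology of \<^term>\<open>dirichlet_norm M E\<close> on \<^term>\<open>dirichlet_space M E\<close>. Since
  functions are not identified almost everywhere, it need not be Hausdorff; passing to the quotient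
  by functions at distance zero gives the norm topology of the Banach space.\<close>

definition dirichlet_topology :: "'a measure \<Rightarrow> (('a \<Rightarrow> real) \<Rightarrow> ennreal) \<Rightarrow> ('a \<Rightarrow> real) topology" where
  "dirichlet_topology M E = topology (\<lambda>U. U \<subseteq> dirichlet_space M E \<and>
     (\<forall>u\<in>U. \<exists>r>0. \<forall>v\<in>dirichlet_space M E. dirichlet_norm M E (\<lambda>x. v x - u x) < r \<longrightarrow> v \<in> U))"

lemma openin_dirichlet_topology:
  "openin (dirichlet_topology M E) U \<longleftrightarrow> U \<subseteq> dirichlet_space M E \<and>
     (\<forall>u\<in>U. \<exists>r>0. \<forall>v\<in>dirichlet_space M E. dirichlet_norm M E (\<lambda>x. v x - u x) < r \<longrightarrow> v \<in> U)"
proof -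
  let ?P = "\<lambda>U. U \<subseteq> dirichlet_space M E \<and>
     (\<forall>u\<in>U. \<exists>r>0. \<forall>v\<in>dirichlet_space M E. dirichlet_norm M E (\<lambda>x. v x - u x) < r \<longrightarrow> v \<in> U)"
  have Int: "?P (S \<inter> T)" if S: "?P S" and T: "?P T" for S T
  proof (intro conjI ballI)
    show "S \<inter> T \<subseteq> dirichlet_space M E" using S by blast
    fix u assume u: "u \<in> S \<inter> T"
    obtain r where r: "r > 0"
      "\<forall>v\<in>dirichlet_space M E. dirichlet_norm M E (\<lambda>x. v x - u x) < r \<longrightarrow> v \<in> S"
      using S u by blast
    obtain s where s: "s > 0"
      "\<forall>v\<in>dirichlet_space M E. dirichlet_norm M E (\<lambda>x. v x - u x) < s \<longrightarrow> v \<in> T"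
      using T u by blast
    show "\<exists>r>0. \<forall>v\<in>dirichlet_space M E. dirichlet_norm M E (\<lambda>x. v x - u x) < r \<longrightarrow> v \<in> S \<inter> T"
      using r s by (intro exI[of _ "min r s"]) simp
  qed
  have Un: "?P (\<Union>K)" if K: "\<forall>U\<in>K. ?P U" for K
  proof (intro conjI ballI)
    show "\<Union>K \<subseteq> dirichlet_space M E" using K by blast
    fix u assume "u \<in> \<Union>K"
    then obtain U where U: "U \<in> K" "u \<in> U" by blast
    obtain r where "r > 0"
      "\<forall>v\<in>dirichlet_space M E. dirichlet_norm M E (\<lambda>x. v x - u x) < r \<longrightarrow> v \<in> U"
      using K U by blast
    then show "\<exists>r>0. \<forall>v\<in>dirichlet_space M E. dirichlet_norm M E (\<lambda>x. v x - u x) < r \<longrightarrow> v \<in> \<Union>K"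
      using U by (intro exI[of _ r]) blast
  qed
  have "istopology ?P"
    unfolding istopology_def
  proof (rule conjI)
    show "\<forall>S T. ?P S \<longrightarrow> ?P T \<longrightarrow> ?P (S \<inter> T)"
      by (rule allI, rule allI, rule impI, rule impI, rule Int)
    show "\<forall>K. (\<forall>U\<in>K. ?P U) \<longrightarrow> ?P (\<Union>K)"
      by (rule allI, rule impI, rule Un)
  qed
  then show ?thesis
    unfolding dirichlet_topology_def by (simp add: topology_inverse')
qed

lemma topspace_dirichlet_topology:
  "topspace (dirichlet_topology M E) = dirichlet_space M E"
proof
  show "topspace (dirichlet_topology M E) \<subseteq> dirichlet_space M E"
    unfolding topspace_def openin_dirichlet_topology by blast
  have "openin (dirichlet_topology M E) (dirichlet_space M E)"
    unfolding openin_dirichlet_topology using zero_less_one by blast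
  then show "dirichlet_space M E \<subseteq> topspace (dirichlet_topology M E)"
    by (rule openin_subset)
qed

end

theory Submission
  imports Defs
begin

text \<open>Both lattice operations are expressed by \<open>w \<mapsto> w\<^sub>+\<close>, since \<open>u \<or> v = v + (u - v)\<^sub>+\<close> and
  \<open>u \<and> v = u - (u - v)\<^sub>+\<close>, and pointwise
  \<open>(w + h)\<^sub>+ - w\<^sub>+ = h\<^sub>+ - (w\<^sub>- \<and> h\<^sub>+) - (w\<^sub>+ \<and> h\<^sub>-)\<close>.
  By (1) with \<open>v = 0\<close> and symmetry, \<open>h\<^sub>+\<close> and \<open>h\<^sub>-\<close> tend to \<open>0\<close> together with \<open>h\<close>. So it suffices that
  \<open>a \<and> k \<rightarrow> 0\<close> in the Dirichlet norm for fixed \<open>a \<ge> 0\<close> as \<open>0 \<le> k \<rightarrow> 0\<close>. By (1),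
  \<open>\<E>(a \<and> k) + \<E>(a \<or> k) \<le> \<E>(a) + \<E>(k)\<close>; here \<open>\<E>(k) \<rightarrow> 0\<close> and
  \<open>liminf \<E>(a \<or> k) \<ge> \<E>(a)\<close> by lower semicontinuity, hence \<open>\<E>(a \<and> k) \<rightarrow> 0\<close>. Quasilinearity keeps
  \<open>\<E>(a / l)\<close> finite for every \<open>l > 0\<close>, which lifts this from \<open>\<E>\<close> to the norm.\<close>

section \<open>Square integrable functions and their norm\<close>

lemma L2_dominated:
  assumes "u \<in> L2 M" "v \<in> borel_measurable M" "\<And>x. \<bar>v x\<bar> \<le> \<bar>u x\<bar>"
  shows "v \<in> L2 M" "L2_norm M v \<le> L2_norm M u"
proof -
  have sq: "(v x)\<^sup>2 \<le> (u x)\<^sup>2" for x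
    using assms(3) by (simp add: abs_le_square_iff)
  have int: "integrable M (\<lambda>x. (u x)\<^sup>2)"
    using assms(1) by (simp add: L2_def)
  have "integrable M (\<lambda>x. (v x)\<^sup>2)"
    by (rule Bochner_Integration.integrable_bound[OF int]) (use assms(2) sq in auto)
  then show "v \<in> L2 M" and "L2_norm M v \<le> L2_norm M u"
    using assms(2) int sq by (auto simp: L2_def L2_norm_def intro!: integral_mono)
qed

lemma L2_add:
  assumes "u \<in> L2 M" "v \<in> L2 M"
  shows "(\<lambda>x. u x + v x) \<in> L2 M"
proof -
  have int: "integrable M (\<lambda>x. 2 * (u x)\<^sup>2 + 2 * (v x)\<^sup>2)"
    using assms by (auto simp: L2_def)
  have "(u x + v x)\<^sup>2 \<le> 2 * (u x)\<^sup>2 + 2 * (v x)\<^sup>2" for x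
    using zero_le_power2[of "u x - v x"] by (simp add: power2_eq_square algebra_simps)
  then have "integrable M (\<lambda>x. (u x + v x)\<^sup>2)"
    using assms by (intro Bochner_Integration.integrable_bound[OF int]) (auto simp: L2_def)
  then show ?thesis
    using assms by (auto simp: L2_def)
qed

lemma L2_cmult: "u \<in> L2 M \<Longrightarrow> (\<lambda>x. c * u x) \<in> L2 M" for c :: real
  by (auto simp: L2_def power_mult_distrib)

lemma L2_divide: "u \<in> L2 M \<Longrightarrow> (\<lambda>x. u x / c) \<in> L2 M" for c :: real
  using L2_cmult[of u M "1 / c"] by simp

lemma L2_uminus: "u \<in> L2 M \<Longrightarrow> (\<lambda>x. - u x) \<in> L2 M"
  using L2_cmult[of u M "-1"] by simp

lemma L2_diff: "u \<in> L2 M \<Longrightarrow> v \<in> L2 M \<Longrightarrow> (\<lambda>x. u x - v x) \<in> L2 M"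
  using L2_add[OF _ L2_uminus, of u M v] by simp

lemma L2_zero: "(\<lambda>x. 0) \<in> L2 M"
  by (simp add: L2_def)

lemma L2_pos_part: "u \<in> L2 M \<Longrightarrow> (\<lambda>x. pos_part (u x)) \<in> L2 M"
  by (rule L2_dominated(1)) (auto simp: L2_def pos_part_def)

lemma L2_neg_part: "u \<in> L2 M \<Longrightarrow> (\<lambda>x. neg_part (u x)) \<in> L2 M"
  by (rule L2_dominated(1)) (auto simp: L2_def neg_part_def)

lemma meet_fun_eq: "meet_fun u v = (\<lambda>x. u x - pos_part (u x - v x))"
  by (auto simp: meet_fun_def pos_part_def)

lemma join_fun_eq: "join_fun u v = (\<lambda>x. v x + pos_part (u x - v x))"
  by (auto simp: join_fun_def pos_part_def)

lemma L2_meet: "u \<in> L2 M \<Longrightarrow> v \<in> L2 M \<Longrightarrow> meet_fun u v \<in> L2 M"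
  unfolding meet_fun_eq by (intro L2_diff L2_pos_part)

lemma L2_join: "u \<in> L2 M \<Longrightarrow> v \<in> L2 M \<Longrightarrow> join_fun u v \<in> L2 M"
  unfolding join_fun_eq by (intro L2_add L2_diff L2_pos_part)

lemma L2_norm_nonneg: "0 \<le> L2_norm M u"
  by (simp add: L2_norm_def)

lemma L2_norm_power2: "(L2_norm M u)\<^sup>2 = (\<integral>x. (u x)\<^sup>2 \<partial>M)"
  by (simp add: L2_norm_def)

text \<open>Convexity is stated for the squared norm because that is the term occurring in
  \<open>E1\<close>. Pointwise, the gap between the two sides is t (1 - t) (u - v)^2.\<close>

lemma L2_norm_power2_convex:
  assumes "u \<in> L2 M" "v \<in> L2 M" "0 \<le> t" "t \<le> 1"
  shows "(L2_norm M (\<lambda>x. t * u x + (1 - t) * v x))\<^sup>2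
    \<le> t * (L2_norm M u)\<^sup>2 + (1 - t) * (L2_norm M v)\<^sup>2"
proof -
  have int: "integrable M (\<lambda>x. (u x)\<^sup>2)" "integrable M (\<lambda>x. (v x)\<^sup>2)"
    using assms by (auto simp: L2_def)
  have "(t * a + (1 - t) * b)\<^sup>2 \<le> t * a\<^sup>2 + (1 - t) * b\<^sup>2" for a b :: real
  proof -
    have "t * a\<^sup>2 + (1 - t) * b\<^sup>2 - (t * a + (1 - t) * b)\<^sup>2 = t * (1 - t) * (a - b)\<^sup>2"
      by (simp add: power2_eq_square algebra_simps)
    moreover have "0 \<le> t * (1 - t) * (a - b)\<^sup>2"
      using assms by simp
    ultimately show ?thesis by linarith
  qed
  then have "(\<integral>x. (t * u x + (1 - t) * v x)\<^sup>2 \<partial>M)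
      \<le> (\<integral>x. t * (u x)\<^sup>2 + (1 - t) * (v x)\<^sup>2 \<partial>M)"
    using L2_add[OF L2_cmult[OF assms(1)] L2_cmult[OF assms(2)], of t "1 - t"] int
    by (intro integral_mono) (auto simp: L2_def)
  also have "\<dots> = t * (\<integral>x. (u x)\<^sup>2 \<partial>M) + (1 - t) * (\<integral>x. (v x)\<^sup>2 \<partial>M)"
    using int by simp
  finally show ?thesis
    by (simp add: L2_norm_power2)
qed

section \<open>Strict bounds on the norm and splitting of errors\<close>

text \<open>The infimum need not be known to be attained, so norm estimates below are phrased as
  strict bounds: each amounts to exhibiting one admissible scale l below r. The case r = \<infinity>
  expresses membership in the Dirichlet space.\<close>

lemma dirichlet_norm_less_iff:
  "dirichlet_norm M E u < r \<longleftrightarrow> (\<exists>l>0. ennreal l < r \<and> E1 M E (\<lambda>x. u x / l) \<le> 1)"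
  unfolding dirichlet_norm_def Inf_less_iff by auto

text \<open>Shares an error r, possibly infinite, among the three summands of (w + h)_+ - w_+. Where
  only two summands occur, one copy of s is dropped.\<close>

lemma ennreal_third:
  assumes "0 < (r::ennreal)"
  obtains s where "0 < s" "s + s + s \<le> r"
proof
  show "0 < r / 3" using assms by (simp add: ennreal_zero_less_divide)
  have "r / 3 + r / 3 + r / 3 = (r / 3) * (1 + 1 + 1)"
    by (simp only: distrib_left mult_1_right)
  also have "\<dots> = r * 3 / 3"
    by (simp add: ennreal_times_divide mult.commute)
  also have "\<dots> = r"
    by (rule mult_divide_eq_ennreal) auto
  finally show "r / 3 + r / 3 + r / 3 \<le> r" by simp
qed

text \<open>Turns a possibly infinite radius into a real number by which functions can be
  divided.\<close>

lemma ennreal_dense_real: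
  assumes "0 < (r::ennreal)"
  obtains l where "0 < l" "ennreal l < r"
proof -
  obtain s where s: "0 < s" "s < r"
    using dense[OF assms] by blast
  then obtain l where "s = ennreal l" "0 \<le> l"
    by (cases s) auto
  with s that show thesis by auto
qed

section \<open>Scaling, convexity and positive parts for the form\<close>

locale quasilinear_dirichlet_form =
  fixes M :: "'a measure" and E :: "('a \<Rightarrow> real) \<Rightarrow> ennreal"
  assumes dirichlet: "dirichlet_form M E"
    and symmetric: "symmetric_form M E"
    and quasilinear: "quasilinear_form M E"
begin

lemma E_zero: "E (\<lambda>x. 0) = 0"
  using symmetric by (simp add: symmetric_form_def)

lemma E_uminus: "u \<in> L2 M \<Longrightarrow> E (\<lambda>x. - u x) = E u"
  using symmetric by (simp add: symmetric_form_def)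

lemma E_convex:
  "u \<in> L2 M \<Longrightarrow> v \<in> L2 M \<Longrightarrow> 0 \<le> t \<Longrightarrow> t \<le> 1 \<Longrightarrow>
    E (\<lambda>x. t * u x + (1 - t) * v x) \<le> ennreal t * E u + ennreal (1 - t) * E v"
  using dirichlet unfolding dirichlet_form_def convex_on_L2_def by blast

lemma E_lattice:
  "u \<in> L2 M \<Longrightarrow> v \<in> L2 M \<Longrightarrow> E (meet_fun u v) + E (join_fun u v) \<le> E u + E v"
  using dirichlet unfolding dirichlet_form_def by blast

lemma E_lsc:
  "u \<in> L2 M \<Longrightarrow> c < E u \<Longrightarrow>
    \<exists>\<delta>>0. \<forall>v\<in>L2 M. L2_norm M (\<lambda>x. v x - u x) < \<delta> \<longrightarrow> c < E v"
  using dirichlet unfolding dirichlet_form_def lsc_on_L2_def by blast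

text \<open>Convexity along the segment from u to 0, where E vanishes.\<close>

lemma E_scale_le:
  assumes "u \<in> L2 M" "0 \<le> t" "t \<le> 1"
  shows "E (\<lambda>x. t * u x) \<le> ennreal t * E u"
  using E_convex[OF assms(1) L2_zero assms(2,3)] by (simp add: E_zero)

lemma E1_convex:
  assumes "u \<in> L2 M" "v \<in> L2 M" "0 \<le> t" "t \<le> 1"
  shows "E1 M E (\<lambda>x. t * u x + (1 - t) * v x) \<le> ennreal t * E1 M E u + ennreal (1 - t) * E1 M E v"
proof -
  have "ennreal ((L2_norm M (\<lambda>x. t * u x + (1 - t) * v x))\<^sup>2)
      \<le> ennreal (t * (L2_norm M u)\<^sup>2 + (1 - t) * (L2_norm M v)\<^sup>2)"
    by (rule ennreal_leI[OF L2_norm_power2_convex[OF assms]])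
  also have "\<dots> = ennreal t * ennreal ((L2_norm M u)\<^sup>2) + ennreal (1 - t) * ennreal ((L2_norm M v)\<^sup>2)"
    using assms by (simp add: ennreal_plus ennreal_mult)
  finally show ?thesis
    using add_mono[OF _ E_convex[OF assms]] by (fastforce simp: E1_def distrib_left ac_simps)
qed

lemma E1_uminus: "u \<in> L2 M \<Longrightarrow> E1 M E (\<lambda>x. - u x) = E1 M E u"
  by (simp add: E1_def E_uminus L2_norm_def)

lemma E1_pos_part_le:
  assumes "u \<in> L2 M"
  shows "E1 M E (\<lambda>x. pos_part (u x)) \<le> E1 M E u"
proof -
  have "E (\<lambda>x. pos_part (u x)) = E (join_fun u (\<lambda>x. 0))"
    by (simp add: join_fun_eq)
  also have "\<dots> \<le> E (meet_fun u (\<lambda>x. 0)) + E (join_fun u (\<lambda>x. 0))"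
    by simp
  also have "\<dots> \<le> E u"
    using E_lattice[OF assms L2_zero] by (simp add: E_zero)
  finally have "E (\<lambda>x. pos_part (u x)) \<le> E u" .
  moreover have "L2_norm M (\<lambda>x. pos_part (u x)) \<le> L2_norm M u"
    using assms L2_pos_part[OF assms]
    by (intro L2_dominated(2)) (auto simp: L2_def pos_part_def)
  ultimately show ?thesis
    unfolding E1_def by (intro add_mono ennreal_leI power_mono L2_norm_nonneg)
qed

section \<open>Seminorm and lattice properties of the Dirichlet norm\<close>

text \<open>The usual argument for a Luxemburg norm: if l is admissible for u and m for v, then (u +
  v) / (l + m) is the convex combination of u / l and v / m with weights l / (l + m) and m / (l +
  m), so l + m is admissible for the sum.\<close>

lemma dirichlet_norm_add_less:
  assumes "u \<in> L2 M" "v \<in> L2 M" "dirichlet_norm M E u < r" "dirichlet_norm M E v < s"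
  shows "dirichlet_norm M E (\<lambda>x. u x + v x) < r + s"
proof -
  obtain l where l: "l > 0" "ennreal l < r" "E1 M E (\<lambda>x. u x / l) \<le> 1"
    using assms(3) by (auto simp: dirichlet_norm_less_iff)
  obtain m where m: "m > 0" "ennreal m < s" "E1 M E (\<lambda>x. v x / m) \<le> 1"
    using assms(4) by (auto simp: dirichlet_norm_less_iff)
  define t where "t = l / (l + m)"
  have t: "0 \<le> t" "t \<le> 1" and t1: "1 - t = m / (l + m)"
    using l(1) m(1) by (auto simp: t_def field_simps)
  have "(\<lambda>x. (u x + v x) / (l + m)) = (\<lambda>x. t * (u x / l) + (1 - t) * (v x / m))"
    unfolding t1 unfolding t_def using l(1) m(1) by (auto simp: add_divide_distrib)
  then have "E1 M E (\<lambda>x. (u x + v x) / (l + m))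
      \<le> ennreal t * E1 M E (\<lambda>x. u x / l) + ennreal (1 - t) * E1 M E (\<lambda>x. v x / m)"
    using E1_convex[OF L2_divide[OF assms(1)] L2_divide[OF assms(2)] t] by simp
  also have "\<dots> \<le> ennreal t * 1 + ennreal (1 - t) * 1"
    using l(3) m(3) by (intro add_mono mult_left_mono) auto
  also have "\<dots> = 1"
    using t by (simp flip: ennreal_plus)
  finally have "E1 M E (\<lambda>x. (u x + v x) / (l + m)) \<le> 1" .
  moreover have "ennreal (l + m) < r + s"
    using l m by (simp add: add_strict_mono)
  ultimately show ?thesis
    unfolding dirichlet_norm_less_iff using l(1) m(1) by (intro exI[of _ "l + m"]) auto
qed

lemma dirichlet_norm_uminus:
  "u \<in> L2 M \<Longrightarrow> dirichlet_norm M E (\<lambda>x. - u x) = dirichlet_norm M E u"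
  using E1_uminus[OF L2_divide] by (simp add: dirichlet_norm_def)

lemma dirichlet_norm_diff_less:
  assumes "u \<in> L2 M" "v \<in> L2 M" "dirichlet_norm M E u < r" "dirichlet_norm M E v < s"
  shows "dirichlet_norm M E (\<lambda>x. u x - v x) < r + s"
  using dirichlet_norm_add_less[OF assms(1) L2_uminus[OF assms(2)] assms(3)] assms
  by (simp add: dirichlet_norm_uminus)

text \<open>Taking positive parts commutes with division by l > 0, so a scale admissible for u stays
  admissible for u_+.\<close>

lemma dirichlet_norm_pos_part_less:
  assumes "u \<in> L2 M" "dirichlet_norm M E u < r"
  shows "dirichlet_norm M E (\<lambda>x. pos_part (u x)) < r"
proof -
  obtain l where l: "l > 0" "ennreal l < r" "E1 M E (\<lambda>x. u x / l) \<le> 1"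
    using assms by (auto simp: dirichlet_norm_less_iff)
  have "(\<lambda>x. pos_part (u x) / l) = (\<lambda>x. pos_part (u x / l))"
    using l(1) by (auto simp: pos_part_def max_def field_simps)
  then have "E1 M E (\<lambda>x. pos_part (u x) / l) \<le> 1"
    using E1_pos_part_le[OF L2_divide[OF assms(1)]] l(3) by (auto intro: order_trans)
  then show ?thesis
    using l by (auto simp: dirichlet_norm_less_iff)
qed

lemma dirichlet_norm_neg_part_less:
  assumes "u \<in> L2 M" "dirichlet_norm M E u < r"
  shows "dirichlet_norm M E (\<lambda>x. neg_part (u x)) < r"
  using dirichlet_norm_pos_part_less[OF L2_uminus[OF assms(1)]] assms
  by (simp add: dirichlet_norm_uminus pos_part_def neg_part_def)

lemma dirichlet_space_add:
  "u \<in> dirichlet_space M E \<Longrightarrow> v \<in> dirichlet_space M E \<Longrightarrow>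
    (\<lambda>x. u x + v x) \<in> dirichlet_space M E"
  using dirichlet_norm_add_less[of u v \<infinity> \<infinity>] by (simp add: dirichlet_space_def L2_add)

lemma dirichlet_space_diff:
  "u \<in> dirichlet_space M E \<Longrightarrow> v \<in> dirichlet_space M E \<Longrightarrow>
    (\<lambda>x. u x - v x) \<in> dirichlet_space M E"
  using dirichlet_norm_diff_less[of u v \<infinity> \<infinity>] by (simp add: dirichlet_space_def L2_diff)

lemma dirichlet_space_pos_part:
  "u \<in> dirichlet_space M E \<Longrightarrow> (\<lambda>x. pos_part (u x)) \<in> dirichlet_space M E"
  using dirichlet_norm_pos_part_less[of u \<infinity>] by (simp add: dirichlet_space_def L2_pos_part)

lemma dirichlet_space_neg_part:
  "u \<in> dirichlet_space M E \<Longrightarrow> (\<lambda>x. neg_part (u x)) \<in> dirichlet_space M E"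
  using dirichlet_norm_neg_part_less[of u \<infinity>] by (simp add: dirichlet_space_def L2_neg_part)

lemma eff_dom_cmult: "u \<in> eff_dom M E \<Longrightarrow> (\<lambda>x. c * u x) \<in> eff_dom M E"
  using quasilinear by (simp add: quasilinear_form_def)

text \<open>Membership in the Dirichlet space yields finiteness at a single scale m. Quasilinearity
  enters here: the effective domain is closed under multiplication by m / l, however large.\<close>

lemma E_divide_finite:
  assumes "u \<in> dirichlet_space M E" "0 < l"
  shows "E (\<lambda>x. u x / l) < \<infinity>"
proof -
  obtain m where m: "m > 0" "E1 M E (\<lambda>x. u x / m) \<le> 1"
    using assms(1) by (auto simp: dirichlet_space_def dirichlet_norm_less_iff)
  have "E (\<lambda>x. u x / m) \<le> E1 M E (\<lambda>x. u x / m)"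
    by (simp add: E1_def)
  also have "\<dots> < \<infinity>"
    using m(2) by (auto intro: le_less_trans)
  finally have "(\<lambda>x. u x / m) \<in> eff_dom M E"
    using assms(1) by (simp add: eff_dom_def dirichlet_space_def L2_divide)
  then have "(\<lambda>x. m / l * (u x / m)) \<in> eff_dom M E"
    by (rule eff_dom_cmult)
  then show ?thesis
    using m(1) by (simp add: eff_dom_def)
qed

section \<open>Meets of a fixed function with small functions\<close>

text \<open>The bound 1 says that scale 1 is admissible for a \<and> k. It is reached as 1/2 + 1/2:
  the energy of a \<and> k is at most 1/4 from lower semicontinuity plus 1/4 from E(k), and its
  squared L2 norm is at most 1/16.\<close>

lemma E1_meet_small:
  assumes a: "a \<in> L2 M" "\<And>x. 0 \<le> a x" "E a < \<infinity>"
  shows "\<exists>\<delta>>0. \<forall>k\<in>L2 M. (\<forall>x. 0 \<le> k x) \<longrightarrow> dirichlet_norm M E k < ennreal \<delta> \<longrightarrow>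
    E1 M E (meet_fun a k) \<le> 1"
proof -
  \<comment> \<open>Lower semicontinuity at a in additive form. It needs a level strictly below
    E(a): this is E(a) - 1/4 when E(a) is finite and above 1/4. For E(a) \<le> 1/4 the subtraction
    truncates to 0, but then the claim is trivial and any \<delta> serves.\<close>
  have "\<exists>\<delta>>0. \<forall>v\<in>L2 M. L2_norm M (\<lambda>x. v x - a x) < \<delta> \<longrightarrow> E a \<le> E v + ennreal (1/4)"
  proof (cases "E a \<le> ennreal (1/4)")
    case True
    then show ?thesis
      by (intro exI[of _ 1]) (auto intro: add_increasing)
  next
    case False
    then have "E a - ennreal (1/4) < E a"
      using a(3) by (intro ennreal_between) (auto simp: zero_less_iff_neq_zero)
    from E_lsc[OF a(1) this] obtain \<delta> where "\<delta> > 0"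
      and \<delta>: "\<And>v. v \<in> L2 M \<Longrightarrow> L2_norm M (\<lambda>x. v x - a x) < \<delta> \<Longrightarrow> E a - ennreal (1/4) < E v"
      by blast
    have "E a \<le> E v + ennreal (1/4)" if "v \<in> L2 M" "L2_norm M (\<lambda>x. v x - a x) < \<delta>" for v
      using less_imp_le[OF \<delta>[OF that]] by (simp add: ennreal_minus_le_iff add.commute)
    then show ?thesis
      using \<open>\<delta> > 0\<close> by blast
  qed
  then obtain \<delta> where "\<delta> > 0"
    and \<delta>: "\<And>v. v \<in> L2 M \<Longrightarrow> L2_norm M (\<lambda>x. v x - a x) < \<delta> \<Longrightarrow> E a \<le> E v + ennreal (1/4)"
    by blast
  \<comment> \<open>The bound \<delta> keeps a \<or> k within reach of lower semicontinuity at a;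
    the bound 1/4 controls both E(k) and the L2 norm of a \<and> k.\<close>
  have "E1 M E (meet_fun a k) \<le> 1"
    if k: "k \<in> L2 M" "\<And>x. 0 \<le> k x" "dirichlet_norm M E k < ennreal (min \<delta> (1/4))" for k
  proof -
    obtain l where l: "l > 0" "l < \<delta>" "l < 1/4" "E1 M E (\<lambda>x. k x / l) \<le> 1"
      using k(3) by (auto simp: dirichlet_norm_less_iff ennreal_less_iff)
    have "ennreal ((L2_norm M (\<lambda>x. k x / l))\<^sup>2) \<le> E1 M E (\<lambda>x. k x / l)"
      and "E (\<lambda>x. k x / l) \<le> E1 M E (\<lambda>x. k x / l)"
      by (simp_all add: E1_def)
    from this[THEN order_trans, OF l(4)]
    have norm_kl: "(L2_norm M (\<lambda>x. k x / l))\<^sup>2 \<le> 1" and E_kl: "E (\<lambda>x. k x / l) \<le> 1"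
      by simp_all
    \<comment> \<open>As l < 1, scaling back from k / l turns E(k / l) \<le> 1 into E(k) \<le>
      l.\<close>
    have "E k = E (\<lambda>x. l * (k x / l))"
      using l(1) by simp
    also have "\<dots> \<le> ennreal l * E (\<lambda>x. k x / l)"
      using l by (intro E_scale_le L2_divide k(1)) auto
    also have "\<dots> \<le> ennreal l"
      using mult_left_mono[OF E_kl, of "ennreal l"] by simp
    also have "\<dots> \<le> ennreal (1/4)"
      using l by (intro ennreal_leI) simp
    finally have E_k: "E k \<le> ennreal (1/4)" .
    have "L2_norm M k / l = L2_norm M (\<lambda>x. k x / l)"
      using l(1) by (simp add: L2_norm_def power_divide real_sqrt_divide)
    also have "\<dots> \<le> 1"
      by (rule power2_le_imp_le) (simp_all add: norm_kl)
    finally have norm_k: "L2_norm M k \<le> l"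
      using l(1) by simp
    have L2: "meet_fun a k \<in> L2 M" "join_fun a k \<in> L2 M"
      using a(1) k(1) by (auto intro: L2_meet L2_join)
    \<comment> \<open>For a, k \<ge> 0 the difference (a \<or> k) - a = (k - a)_+ lies between 0 and
      k, so a \<or> k is close to a in L2.\<close>
    have "L2_norm M (\<lambda>x. join_fun a k x - a x) \<le> L2_norm M k"
    proof (rule L2_dominated(2)[OF k(1)])
      show "(\<lambda>x. join_fun a k x - a x) \<in> borel_measurable M"
        using L2_diff[OF L2(2) a(1)] by (simp add: L2_def)
      show "\<bar>join_fun a k x - a x\<bar> \<le> \<bar>k x\<bar>" for x
        using k(2)[of x] a(2)[of x] by (simp add: join_fun_def max_def)
    qed
    then have Ea: "E a \<le> E (join_fun a k) + ennreal (1/4)"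
      using norm_k l by (intro \<delta> L2) auto
    \<comment> \<open>Finiteness of E(a \<or> k) is what permits cancelling it in the extended reals
      afterwards.\<close>
    have "E (join_fun a k) \<le> E (meet_fun a k) + E (join_fun a k)"
      by simp
    also have "\<dots> \<le> E a + E k"
      by (rule E_lattice[OF a(1) k(1)])
    also have "\<dots> < \<infinity>"
      using a(3) le_less_trans[OF E_k ennreal_less_top] by simp
    finally have fin: "E (join_fun a k) \<noteq> top"
      by auto
    have "E (join_fun a k) + E (meet_fun a k) \<le> E a + E k"
      using E_lattice[OF a(1) k(1)] by (simp add: add.commute)
    also have "\<dots> \<le> (E (join_fun a k) + ennreal (1/4)) + ennreal (1/4)"
      by (rule add_mono[OF Ea E_k])
    also have "\<dots> = E (join_fun a k) + ennreal (1/2)"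
      by (simp add: add.assoc flip: ennreal_plus)
    finally have E_meet: "E (meet_fun a k) \<le> ennreal (1/2)"
      using fin by (simp add: ennreal_add_left_cancel_le)
    have "L2_norm M (meet_fun a k) \<le> L2_norm M k"
    proof (rule L2_dominated(2)[OF k(1)])
      show "meet_fun a k \<in> borel_measurable M"
        using L2(1) by (simp add: L2_def)
      show "\<bar>meet_fun a k x\<bar> \<le> \<bar>k x\<bar>" for x
        using k(2)[of x] a(2)[of x] by (simp add: meet_fun_def min_def)
    qed
    then have "L2_norm M (meet_fun a k) \<le> 1/4"
      using norm_k l by simp
    then have "(L2_norm M (meet_fun a k))\<^sup>2 \<le> (1/4)\<^sup>2"
      by (intro power_mono L2_norm_nonneg)
    then have "ennreal ((L2_norm M (meet_fun a k))\<^sup>2) \<le> ennreal (1/2)"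
      by (intro ennreal_leI) (simp add: power2_eq_square)
    from add_mono[OF this E_meet]
    have "E1 M E (meet_fun a k) \<le> ennreal (1/2) + ennreal (1/2)"
      unfolding E1_def .
    also have "\<dots> = 1"
      by (subst ennreal_plus[symmetric]) simp_all
    finally show ?thesis .
  qed
  then show ?thesis
    using \<open>\<delta> > 0\<close> by (intro exI[of _ "min \<delta> (1/4)"]) auto
qed

text \<open>Rescaling by some l < r: meets commute with division by l, so
  \<open>E1_meet_small\<close> for a / l and k / l makes l admissible for a \<and> k. A scale m of k
  becomes the scale m / l of k / l, whence the threshold l * \<delta>.\<close>

lemma dirichlet_norm_meet_small:
  assumes a: "a \<in> dirichlet_space M E" "\<And>x. 0 \<le> a x" and "0 < r"
  shows "\<exists>\<delta>>0. \<forall>k\<in>L2 M. (\<forall>x. 0 \<le> k x) \<longrightarrow> dirichlet_norm M E k < \<delta> \<longrightarrow>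
    dirichlet_norm M E (meet_fun a k) < r"
proof -
  obtain l where l: "0 < l" "ennreal l < r"
    using ennreal_dense_real[OF \<open>0 < r\<close>] .
  have L2: "a \<in> L2 M"
    using a(1) by (simp add: dirichlet_space_def)
  obtain \<delta> where "\<delta> > 0" and \<delta>: "\<And>k. k \<in> L2 M \<Longrightarrow> \<forall>x. 0 \<le> k x \<Longrightarrow>
      dirichlet_norm M E k < ennreal \<delta> \<Longrightarrow> E1 M E (meet_fun (\<lambda>x. a x / l) k) \<le> 1"
    using E1_meet_small[OF L2_divide[OF L2], of l] E_divide_finite[OF a(1) l(1)] a(2) l(1) by auto
  have "dirichlet_norm M E (meet_fun a k) < r"
    if k: "k \<in> L2 M" "\<forall>x. 0 \<le> k x" "dirichlet_norm M E k < ennreal (l * \<delta>)" for k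
  proof -
    obtain m where m: "m > 0" "m < l * \<delta>" "E1 M E (\<lambda>x. k x / m) \<le> 1"
      using k(3) by (auto simp: dirichlet_norm_less_iff ennreal_less_iff)
    have "m / l > 0" "m / l < \<delta>" "E1 M E (\<lambda>x. (k x / l) / (m / l)) \<le> 1"
      using m l(1) by (auto simp: field_simps)
    then have "dirichlet_norm M E (\<lambda>x. k x / l) < ennreal \<delta>"
      unfolding dirichlet_norm_less_iff by (intro exI[of _ "m / l"]) (simp add: ennreal_less_iff)
    then have "E1 M E (meet_fun (\<lambda>x. a x / l) (\<lambda>x. k x / l)) \<le> 1"
      using k l(1) by (intro \<delta> L2_divide) auto
    moreover have "meet_fun (\<lambda>x. a x / l) (\<lambda>x. k x / l) = (\<lambda>x. meet_fun a k x / l)"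
      using l(1) by (auto simp: meet_fun_def min_def field_simps)
    ultimately show ?thesis
      using l by (auto simp: dirichlet_norm_less_iff)
  qed
  then show ?thesis
    using \<open>\<delta> > 0\<close> l(1) by (intro exI[of _ "ennreal (l * \<delta>)"]) auto
qed

section \<open>Continuity of the positive part\<close>

text \<open>The fixed functions in the meets are w_+ and w_-, so \<delta> depends on w: the
  continuity obtained is pointwise, not uniform.\<close>

lemma pos_part_continuous:
  assumes w: "w \<in> dirichlet_space M E" and "0 < r"
  shows "\<exists>\<delta>>0. \<forall>z\<in>L2 M. dirichlet_norm M E (\<lambda>x. z x - w x) < \<delta> \<longrightarrow>
    dirichlet_norm M E (\<lambda>x. pos_part (z x) - pos_part (w x)) < r"
proof -
  obtain s where s: "0 < s" "s + s + s \<le> r"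
    using ennreal_third[OF \<open>0 < r\<close>] .
  have wL: "w \<in> L2 M"
    using w by (simp add: dirichlet_space_def)
  let ?wp = "\<lambda>x. pos_part (w x)" and ?wn = "\<lambda>x. neg_part (w x)"
  obtain d where d: "d > 0" "\<And>k. k \<in> L2 M \<Longrightarrow> \<forall>x. 0 \<le> k x \<Longrightarrow>
      dirichlet_norm M E k < d \<Longrightarrow> dirichlet_norm M E (meet_fun ?wp k) < s"
    using dirichlet_norm_meet_small[OF dirichlet_space_pos_part[OF w] _ s(1)]
    by (auto simp: pos_part_def)
  obtain e where e: "e > 0" "\<And>k. k \<in> L2 M \<Longrightarrow> \<forall>x. 0 \<le> k x \<Longrightarrow>
      dirichlet_norm M E k < e \<Longrightarrow> dirichlet_norm M E (meet_fun ?wn k) < s"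
    using dirichlet_norm_meet_small[OF dirichlet_space_neg_part[OF w] _ s(1)]
    by (auto simp: neg_part_def)
  \<comment> \<open>With h = z - w, the bound s controls h_+ itself, d the meet of w_+ with h_-, and
    e the meet of w_- with h_+.\<close>
  have "dirichlet_norm M E (\<lambda>x. pos_part (z x) - pos_part (w x)) < r"
    if z: "z \<in> L2 M" "dirichlet_norm M E (\<lambda>x. z x - w x) < min s (min d e)" for z
  proof -
    let ?hp = "\<lambda>x. pos_part (z x - w x)" and ?hn = "\<lambda>x. neg_part (z x - w x)"
    have L2: "(\<lambda>x. z x - w x) \<in> L2 M"
      by (rule L2_diff[OF z(1) wL])
    have hp: "?hp \<in> L2 M" and hn: "?hn \<in> L2 M"
      using L2 by (auto intro: L2_pos_part L2_neg_part)
    have nhp: "dirichlet_norm M E ?hp < min s (min d e)"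
      and nhn: "dirichlet_norm M E ?hn < min s (min d e)"
      using dirichlet_norm_pos_part_less[OF L2] dirichlet_norm_neg_part_less[OF L2] z(2) by auto
    have 1: "dirichlet_norm M E (meet_fun ?wp ?hn) < s"
      using nhn by (intro d hn) (auto simp: neg_part_def)
    have 2: "dirichlet_norm M E (meet_fun ?wn ?hp) < s"
      using nhp by (intro e hp) (auto simp: pos_part_def)
    have L2': "meet_fun ?wp ?hn \<in> L2 M" "meet_fun ?wn ?hp \<in> L2 M"
      using wL hp hn by (auto intro: L2_meet L2_pos_part L2_neg_part)
    have "dirichlet_norm M E (\<lambda>x. ?hp x - meet_fun ?wn ?hp x - meet_fun ?wp ?hn x) < s + s + s"
      using nhp by (intro dirichlet_norm_diff_less L2_diff L2' hp 1 2) auto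
    \<comment> \<open>Where h \<ge> 0, the part min(w_-, h) of the increment only fills up w_-, and
      the rest raises w_+. Where h \<le> 0, w_+ loses min(w_+, -h).\<close>
    moreover have "(\<lambda>x. ?hp x - meet_fun ?wn ?hp x - meet_fun ?wp ?hn x)
        = (\<lambda>x. pos_part (z x) - pos_part (w x))"
      by (auto simp: meet_fun_def pos_part_def neg_part_def min_def max_def)
    ultimately show ?thesis
      using s(2) by (auto intro: less_le_trans)
  qed
  then show ?thesis
    using s(1) d(1) e(1) by (intro exI[of _ "min s (min d e)"]) auto
qed

section \<open>Open balls and an epsilon-delta criterion\<close>

lemma openin_dirichlet_ball:
  assumes "u \<in> dirichlet_space M E"
  shows "openin (dirichlet_topology M E)
    {v \<in> dirichlet_space M E. dirichlet_norm M E (\<lambda>x. v x - u x) < r}"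
  unfolding openin_dirichlet_topology
proof (intro conjI ballI)
  fix v assume v: "v \<in> {v \<in> dirichlet_space M E. dirichlet_norm M E (\<lambda>x. v x - u x) < r}"
  \<comment> \<open>The triangle inequality is available for strict bounds only, so s takes the
    place of the distance. Being below r, it makes r - s positive and (r - s) + s = r, even for r =
    \<infinity>.\<close>
  obtain s where s: "dirichlet_norm M E (\<lambda>x. v x - u x) < s" "s < r"
    using v dense by blast
  have "dirichlet_norm M E (\<lambda>x. w x - u x) < r"
    if w: "w \<in> dirichlet_space M E" "dirichlet_norm M E (\<lambda>x. w x - v x) < r - s" for w
  proof -
    have "dirichlet_norm M E (\<lambda>x. (w x - v x) + (v x - u x)) < (r - s) + s"
      using w v assms s by (intro dirichlet_norm_add_less L2_diff) (auto simp: dirichlet_space_def)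
    then show ?thesis
      using s(2) by (simp add: diff_add_cancel_ennreal)
  qed
  then show "\<exists>r'>0. \<forall>w\<in>dirichlet_space M E. dirichlet_norm M E (\<lambda>x. w x - v x) < r' \<longrightarrow>
      w \<in> {v \<in> dirichlet_space M E. dirichlet_norm M E (\<lambda>x. v x - u x) < r}"
    using s(2) by (intro exI[of _ "r - s"]) (auto simp: diff_gr0_ennreal)
qed auto

text \<open>Around each point of the preimage of an open set, the product of two balls of radius
  \<delta> is an open rectangle inside that preimage.\<close>

lemma continuous_map_dirichlet_prodI:
  assumes closed: "\<And>u v. u \<in> dirichlet_space M E \<Longrightarrow> v \<in> dirichlet_space M E \<Longrightarrow>
      F u v \<in> dirichlet_space M E"
    and cont: "\<And>u v r. u \<in> dirichlet_space M E \<Longrightarrow> v \<in> dirichlet_space M E \<Longrightarrow> 0 < r \<Longrightarrow>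
      \<exists>\<delta>>0. \<forall>u'\<in>dirichlet_space M E. \<forall>v'\<in>dirichlet_space M E.
        dirichlet_norm M E (\<lambda>x. u' x - u x) < \<delta> \<longrightarrow> dirichlet_norm M E (\<lambda>x. v' x - v x) < \<delta> \<longrightarrow>
        dirichlet_norm M E (\<lambda>x. F u' v' x - F u v x) < r"
  shows "continuous_map (prod_topology (dirichlet_topology M E) (dirichlet_topology M E))
    (dirichlet_topology M E) (\<lambda>(u, v). F u v)"
  unfolding continuous_map_def
proof (intro conjI allI impI)
  show "(\<lambda>(u, v). F u v)
      \<in> topspace (prod_topology (dirichlet_topology M E) (dirichlet_topology M E))
        \<rightarrow> topspace (dirichlet_topology M E)"
    using closed by (auto simp: topspace_dirichlet_topology)
next
  fix U assume U: "openin (dirichlet_topology M E) U"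
  let ?S = "{p \<in> topspace (prod_topology (dirichlet_topology M E) (dirichlet_topology M E)).
    (case p of (u, v) \<Rightarrow> F u v) \<in> U}"
  let ?B = "\<lambda>u r. {v \<in> dirichlet_space M E. dirichlet_norm M E (\<lambda>x. v x - u x) < r}"
  have "\<exists>A B. openin (dirichlet_topology M E) A \<and> openin (dirichlet_topology M E) B \<and>
      u \<in> A \<and> v \<in> B \<and> A \<times> B \<subseteq> ?S" if "(u, v) \<in> ?S" for u v
  proof -
    have uv: "u \<in> dirichlet_space M E" "v \<in> dirichlet_space M E" "F u v \<in> U"
      using that by (auto simp: topspace_dirichlet_topology)
    obtain r where r: "r > 0" "\<And>w. w \<in> dirichlet_space M E \<Longrightarrow>
        dirichlet_norm M E (\<lambda>x. w x - F u v x) < r \<Longrightarrow> w \<in> U"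
      using U uv(3) unfolding openin_dirichlet_topology by blast
    obtain \<delta> where "\<delta> > 0" and \<delta>: "\<And>u' v'. u' \<in> dirichlet_space M E \<Longrightarrow> v' \<in> dirichlet_space M E \<Longrightarrow>
        dirichlet_norm M E (\<lambda>x. u' x - u x) < \<delta> \<Longrightarrow> dirichlet_norm M E (\<lambda>x. v' x - v x) < \<delta> \<Longrightarrow>
        dirichlet_norm M E (\<lambda>x. F u' v' x - F u v x) < r"
      using cont[OF uv(1,2) r(1)] by blast
    \<comment> \<open>Centres lie in their balls: since E(0) = 0, every positive scale is admissible
      for the zero function.\<close>
    have zero: "dirichlet_norm M E (\<lambda>x. w x - w x) < \<delta>" for w :: "'a \<Rightarrow> real"
    proof -
      obtain l where "0 < l" "ennreal l < \<delta>"
        using ennreal_dense_real[OF \<open>\<delta> > 0\<close>] .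
      then show ?thesis
        unfolding dirichlet_norm_less_iff
        by (intro exI[of _ l]) (simp add: E1_def E_zero L2_norm_def)
    qed
    have "?B u \<delta> \<times> ?B v \<delta> \<subseteq> ?S"
      using \<delta> r(2) closed by (auto simp: topspace_dirichlet_topology)
    then show ?thesis
      using openin_dirichlet_ball uv(1,2) zero
      by (intro exI[of _ "?B u \<delta>"] exI[of _ "?B v \<delta>"]) auto
  qed
  then show "openin (prod_topology (dirichlet_topology M E) (dirichlet_topology M E)) ?S"
    unfolding openin_prod_topology_alt by blast
qed

section \<open>Continuity of meet and join\<close>

text \<open>Composes subtraction with the positive part. The extra bound \<delta> \<le> r lets the
  same \<delta> also control the increment of u or v that accompanies (u - v)_+ in the lattice
  operations.\<close>

lemma pos_part_diff_continuous:
  assumes uv: "u \<in> dirichlet_space M E" "v \<in> dirichlet_space M E" and "0 < r"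
  shows "\<exists>\<delta>>0. \<delta> \<le> r \<and> (\<forall>u'\<in>dirichlet_space M E. \<forall>v'\<in>dirichlet_space M E.
    dirichlet_norm M E (\<lambda>x. u' x - u x) < \<delta> \<longrightarrow> dirichlet_norm M E (\<lambda>x. v' x - v x) < \<delta> \<longrightarrow>
    dirichlet_norm M E (\<lambda>x. pos_part (u' x - v' x) - pos_part (u x - v x)) < r)"
proof -
  obtain d where "d > 0" and d: "\<And>z. z \<in> L2 M \<Longrightarrow>
      dirichlet_norm M E (\<lambda>x. z x - (u x - v x)) < d \<Longrightarrow>
      dirichlet_norm M E (\<lambda>x. pos_part (z x) - pos_part (u x - v x)) < r"
    using pos_part_continuous[OF dirichlet_space_diff[OF uv] \<open>0 < r\<close>] by blast
  obtain e where e: "0 < e" "e + e + e \<le> d"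
    using ennreal_third[OF \<open>d > 0\<close>] .
  have ee: "e + e \<le> d"
    using e(2) by (rule order_trans[rotated]) simp
  have "dirichlet_norm M E (\<lambda>x. pos_part (u' x - v' x) - pos_part (u x - v x)) < r"
    if uv': "u' \<in> dirichlet_space M E" "v' \<in> dirichlet_space M E"
      and "dirichlet_norm M E (\<lambda>x. u' x - u x) < e" "dirichlet_norm M E (\<lambda>x. v' x - v x) < e"
    for u' v'
  proof (rule d)
    show "(\<lambda>x. u' x - v' x) \<in> L2 M"
      using uv' by (auto simp: dirichlet_space_def intro: L2_diff)
    have "dirichlet_norm M E (\<lambda>x. (u' x - u x) - (v' x - v x)) < e + e"
      using that uv by (intro dirichlet_norm_diff_less L2_diff) (auto simp: dirichlet_space_def)
    also have "(\<lambda>x. (u' x - u x) - (v' x - v x)) = (\<lambda>x. u' x - v' x - (u x - v x))"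
      by auto
    finally show "dirichlet_norm M E (\<lambda>x. u' x - v' x - (u x - v x)) < d"
      using ee by (rule less_le_trans)
  qed
  then show ?thesis
    using e(1) \<open>0 < r\<close> by (intro exI[of _ "min e r"]) auto
qed

lemma continuous_map_meet:
  "continuous_map (prod_topology (dirichlet_topology M E) (dirichlet_topology M E))
    (dirichlet_topology M E) (\<lambda>(u, v). meet_fun u v)"
proof (rule continuous_map_dirichlet_prodI)
  fix u v assume uv: "u \<in> dirichlet_space M E" "v \<in> dirichlet_space M E"
  show "meet_fun u v \<in> dirichlet_space M E"
    unfolding meet_fun_eq using uv
    by (intro dirichlet_space_diff dirichlet_space_pos_part)
  fix r :: ennreal assume "0 < r"
  then obtain s where s: "0 < s" "s + s + s \<le> r"
    using ennreal_third by blast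
  have ss: "s + s \<le> r"
    using s(2) by (rule order_trans[rotated]) simp
  obtain \<delta> where "\<delta> > 0" "\<delta> \<le> s" and \<delta>: "\<And>u' v'. u' \<in> dirichlet_space M E \<Longrightarrow>
      v' \<in> dirichlet_space M E \<Longrightarrow> dirichlet_norm M E (\<lambda>x. u' x - u x) < \<delta> \<Longrightarrow>
      dirichlet_norm M E (\<lambda>x. v' x - v x) < \<delta> \<Longrightarrow>
      dirichlet_norm M E (\<lambda>x. pos_part (u' x - v' x) - pos_part (u x - v x)) < s"
    using pos_part_diff_continuous[OF uv s(1)] by blast
  have "dirichlet_norm M E (\<lambda>x. meet_fun u' v' x - meet_fun u v x) < r"
    if uv': "u' \<in> dirichlet_space M E" "v' \<in> dirichlet_space M E"
      and less: "dirichlet_norm M E (\<lambda>x. u' x - u x) < \<delta>"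
        "dirichlet_norm M E (\<lambda>x. v' x - v x) < \<delta>" for u' v'
  proof -
    \<comment> \<open>The increment of u is below s because \<delta> \<le> s, that of (u - v)_+ by
      the choice of \<delta>.\<close>
    have "dirichlet_norm M E
        (\<lambda>x. (u' x - u x) - (pos_part (u' x - v' x) - pos_part (u x - v x))) < s + s"
      using uv uv' less \<open>\<delta> \<le> s\<close>
      by (intro dirichlet_norm_diff_less L2_diff L2_pos_part \<delta>) (auto simp: dirichlet_space_def)
    also have "(\<lambda>x. (u' x - u x) - (pos_part (u' x - v' x) - pos_part (u x - v x)))
        = (\<lambda>x. meet_fun u' v' x - meet_fun u v x)"
      by (auto simp: meet_fun_eq)
    finally show ?thesis
      using ss by (rule less_le_trans)
  qed
  then show "\<exists>\<delta>>0. \<forall>u'\<in>dirichlet_space M E. \<forall>v'\<in>dirichlet_space M E.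
      dirichlet_norm M E (\<lambda>x. u' x - u x) < \<delta> \<longrightarrow> dirichlet_norm M E (\<lambda>x. v' x - v x) < \<delta> \<longrightarrow>
      dirichlet_norm M E (\<lambda>x. meet_fun u' v' x - meet_fun u v x) < r"
    using \<open>\<delta> > 0\<close> by blast
qed

lemma continuous_map_join:
  "continuous_map (prod_topology (dirichlet_topology M E) (dirichlet_topology M E))
    (dirichlet_topology M E) (\<lambda>(u, v). join_fun u v)"
proof (rule continuous_map_dirichlet_prodI)
  fix u v assume uv: "u \<in> dirichlet_space M E" "v \<in> dirichlet_space M E"
  show "join_fun u v \<in> dirichlet_space M E"
    unfolding join_fun_eq using uv
    by (intro dirichlet_space_add dirichlet_space_diff dirichlet_space_pos_part)
  fix r :: ennreal assume "0 < r"
  then obtain s where s: "0 < s" "s + s + s \<le> r"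
    using ennreal_third by blast
  have ss: "s + s \<le> r"
    using s(2) by (rule order_trans[rotated]) simp
  obtain \<delta> where "\<delta> > 0" "\<delta> \<le> s" and \<delta>: "\<And>u' v'. u' \<in> dirichlet_space M E \<Longrightarrow>
      v' \<in> dirichlet_space M E \<Longrightarrow> dirichlet_norm M E (\<lambda>x. u' x - u x) < \<delta> \<Longrightarrow>
      dirichlet_norm M E (\<lambda>x. v' x - v x) < \<delta> \<Longrightarrow>
      dirichlet_norm M E (\<lambda>x. pos_part (u' x - v' x) - pos_part (u x - v x)) < s"
    using pos_part_diff_continuous[OF uv s(1)] by blast
  have "dirichlet_norm M E (\<lambda>x. join_fun u' v' x - join_fun u v x) < r"
    if uv': "u' \<in> dirichlet_space M E" "v' \<in> dirichlet_space M E"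
      and less: "dirichlet_norm M E (\<lambda>x. u' x - u x) < \<delta>"
        "dirichlet_norm M E (\<lambda>x. v' x - v x) < \<delta>" for u' v'
  proof -
    \<comment> \<open>As for the meet, but with the increment of v, to which that of (u - v)_+ is
      added.\<close>
    have "dirichlet_norm M E
        (\<lambda>x. (v' x - v x) + (pos_part (u' x - v' x) - pos_part (u x - v x))) < s + s"
      using uv uv' less \<open>\<delta> \<le> s\<close>
      by (intro dirichlet_norm_add_less L2_diff L2_pos_part \<delta>) (auto simp: dirichlet_space_def)
    also have "(\<lambda>x. (v' x - v x) + (pos_part (u' x - v' x) - pos_part (u x - v x)))
        = (\<lambda>x. join_fun u' v' x - join_fun u v x)"
      by (auto simp: join_fun_eq)
    finally show ?thesis
      using ss by (rule less_le_trans)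
  qed
  then show "\<exists>\<delta>>0. \<forall>u'\<in>dirichlet_space M E. \<forall>v'\<in>dirichlet_space M E.
      dirichlet_norm M E (\<lambda>x. u' x - u x) < \<delta> \<longrightarrow> dirichlet_norm M E (\<lambda>x. v' x - v x) < \<delta> \<longrightarrow>
      dirichlet_norm M E (\<lambda>x. join_fun u' v' x - join_fun u v x) < r"
    using \<open>\<delta> > 0\<close> by blast
qed

end

theorem theorem4p10:
  fixes M :: "'a::topological_space measure"
    and E :: "('a \<Rightarrow> real) \<Rightarrow> ennreal"
  assumes "countably_generated_borel TYPE('a)"
    and "sets M = sets borel"
    and "sigma_finite_measure M"
    and "measure_support M = UNIV"
    and "dirichlet_form M E"
    and "symmetric_form M E"
    and "quasilinear_form M E"
  shows "continuous_map
           (prod_topology (dirichlet_topology M E) (dirichlet_topology M E))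
           (dirichlet_topology M E) (\<lambda>(u, v). meet_fun u v) \<and>
         continuous_map
           (prod_topology (dirichlet_topology M E) (dirichlet_topology M E))
           (dirichlet_topology M E) (\<lambda>(u, v). join_fun u v)"
proof -
  interpret quasilinear_dirichlet_form M E
    by (rule quasilinear_dirichlet_form.intro) fact+
  show ?thesis
    using continuous_map_meet continuous_map_join by blast
qed

end
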